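(* Let $r\ge0$ be a real number, $l=\{a_i;\ i=1,2,3,\dots\}$ a sequence of real numbers, and $a\in\mathbb{R}$. Then $a=\mathrm{stat}\text{-}r\text{-}\lim l$ if and only if there exists an increasing index sequence $K=\{k_n;\ k_n\in\mathbb{N},\ n=1,2,3,\dots\}$ of natural numbers such that $d(K)=1$ and $a=r\text{-}\lim l_K$, where $l_K=\{a_i;\ i\in K\}$.
   Context: $\mathbb{N}=\{1,2,3,\dots\}$. For $K\subseteq\mathbb{N}$ put $K_n=\{k\in K: k\le n\}$; the asymptotic density of $K$ is $d(K)=\lim_{n\to\infty}\frac1n|K_n|$ whenever the limit exists. For a real $r\ge0$: $a=\mathrm{stat}\text{-}r\text{-}\lim l$ ($a$ is a statistical $r$-limit of $l$) means that for every $\varepsilon>0$ the set $\{i\in\mathbb{N}: |a_i-a|\ge r+\varepsilon\}$ has density $0$. A number $a$ is an $r$-limit of a sequence $\{b_n\}$, written $a=r\text{-}\lim\{b_n\}$, if for every $\varepsilon>0$ the inequality $|b_n-a|<r+\varepsilon$ holds for all sufficiently large $n$. The sequence $l_K$ is the subsequence $\{a_{k_n};\ n=1,2,3,\dots\}$. *)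

theory Defs
  imports "HOL-Analysis.Analysis"
begin

text \<open>
  Natural numbers start at 1 here: sets of naturals are subsets of \<open>{1..}\<close>, and a sequence
  \<open>l :: nat \<Rightarrow> real\<close> stands for \<open>l 1, l 2, \<dots>\<close>; the value \<open>l 0\<close> is never relevant.
\<close>

text \<open>The density is a partial operation, so it is given as a relation: the limit exists and is \<open>d\<close>.\<close>

definition has_density :: "nat set \<Rightarrow> real \<Rightarrow> bool" where
  "has_density K d \<longleftrightarrow> (\<lambda>n. real (card {k \<in> K. 1 \<le> k \<and> k \<le> n}) / real n) \<longlonglongrightarrow> d"

definition is_stat_rlim :: "real \<Rightarrow> (nat \<Rightarrow> real) \<Rightarrow> real \<Rightarrow> bool" where
  "is_stat_rlim r l a \<longleftrightarrow>
     (\<forall>\<epsilon>>0. has_density {i. 1 \<le> i \<and> \<bar>l i - a\<bar> \<ge> r + \<epsilon>} 0)"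

definition is_rlim :: "real \<Rightarrow> (nat \<Rightarrow> real) \<Rightarrow> real \<Rightarrow> bool" where
  "is_rlim r b a \<longleftrightarrow> (\<forall>\<epsilon>>0. \<forall>\<^sub>F n in sequentially. \<bar>b n - a\<bar> < r + \<epsilon>)"

definition index_sequence :: "(nat \<Rightarrow> nat) \<Rightarrow> bool" where
  "index_sequence k \<longleftrightarrow> k ` {1..} \<subseteq> {1..} \<and> strict_mono_on {1..} k"

end

theory Submission
  imports Defs
begin

text \<open>
  Both sides say that the sets
  \<open>{i. \<bar>l i - a\<bar> \<ge> r + \<epsilon>}\<close> are negligible. The left side says it in the sense of density.
  On the right side, a subsequence along an index set \<open>K\<close> has \<open>a\<close> as an \<open>r\<close>-limit exactly when
  each of these sets meets \<open>K\<close> in a finite set (\<open>is_rlim_index_sequence_iff\<close>).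

  If \<open>K\<close> has density 1, a set that meets \<open>K\<close> in a finite set lies, up to finitely many points, in
  the density-zero complement of \<open>K\<close>, so it has density zero. This is one direction.

  For the other direction, one set \<open>Z\<close> of density zero has to absorb all exceptional sets up to
  finite remainders; \<open>K\<close> is then its complement. The exceptional sets grow as \<open>\<epsilon>\<close> decreases, so it
  suffices to treat \<open>\<epsilon> = 1 / (j + 1)\<close>, and for a countable increasing family such a
  \<open>Z\<close> exists (\<open>zero_density_absorbs_increasing\<close>): the sets of density zero form a P-ideal.
\<close>

lemma has_density_zero_subset:
  assumes "has_density B 0" "\<And>i. i \<in> A \<Longrightarrow> 1 \<le> i \<Longrightarrow> i \<in> B"
  shows "has_density A 0"
  unfolding has_density_def
proof (rule tendsto_sandwich[OF _ _ tendsto_const assms(1)[unfolded has_density_def]])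
  have "card {k \<in> A. 1 \<le> k \<and> k \<le> n} \<le> card {k \<in> B. 1 \<le> k \<and> k \<le> n}" for n
    by (rule card_mono) (use assms(2) in auto)
  then show "\<forall>\<^sub>F n in sequentially. real (card {k \<in> A. 1 \<le> k \<and> k \<le> n}) / real n
      \<le> real (card {k \<in> B. 1 \<le> k \<and> k \<le> n}) / real n"
    by (intro always_eventually allI divide_right_mono) auto
qed auto

lemma has_density_zero_Un:
  assumes "has_density A 0" "has_density B 0"
  shows "has_density (A \<union> B) 0"
  unfolding has_density_def
proof (rule tendsto_sandwich[OF _ _ tendsto_const])
  show "(\<lambda>n. real (card {k \<in> A. 1 \<le> k \<and> k \<le> n}) / real n
      + real (card {k \<in> B. 1 \<le> k \<and> k \<le> n}) / real n) \<longlonglongrightarrow> 0"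
    using tendsto_add[OF assms[unfolded has_density_def]] by simp
  have "card {k \<in> A \<union> B. 1 \<le> k \<and> k \<le> n}
      \<le> card {k \<in> A. 1 \<le> k \<and> k \<le> n} + card {k \<in> B. 1 \<le> k \<and> k \<le> n}" for n
  proof -
    have "{k \<in> A \<union> B. 1 \<le> k \<and> k \<le> n}
        = {k \<in> A. 1 \<le> k \<and> k \<le> n} \<union> {k \<in> B. 1 \<le> k \<and> k \<le> n}"
      by auto
    then show ?thesis
      by (simp add: card_Un_le)
  qed
  then have "real (card {k \<in> A \<union> B. 1 \<le> k \<and> k \<le> n}) / real n
      \<le> (real (card {k \<in> A. 1 \<le> k \<and> k \<le> n}) + real (card {k \<in> B. 1 \<le> k \<and> k \<le> n})) / real n" for n
    by (intro divide_right_mono) (simp_all flip: of_nat_add)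
  then show "\<forall>\<^sub>F n in sequentially. real (card {k \<in> A \<union> B. 1 \<le> k \<and> k \<le> n}) / real n
      \<le> real (card {k \<in> A. 1 \<le> k \<and> k \<le> n}) / real n + real (card {k \<in> B. 1 \<le> k \<and> k \<le> n}) / real n"
    by (simp add: add_divide_distrib)
qed auto

lemma has_density_zero_finite:
  assumes "finite A"
  shows "has_density A 0"
  unfolding has_density_def
proof (rule tendsto_sandwich[OF _ _ tendsto_const lim_const_over_n])
  have "card {k \<in> A. 1 \<le> k \<and> k \<le> n} \<le> card A" for n
    by (rule card_mono) (use assms in auto)
  then show "\<forall>\<^sub>F n in sequentially. real (card {k \<in> A. 1 \<le> k \<and> k \<le> n}) / real n
      \<le> real (card A) / real n"
    by (intro always_eventually allI divide_right_mono) auto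
qed auto

lemma has_density_Compl:
  assumes "has_density A d"
  shows "has_density (- A) (1 - d)"
  unfolding has_density_def
proof (rule Lim_transform_eventually)
  show "(\<lambda>n. 1 - real (card {k \<in> A. 1 \<le> k \<and> k \<le> n}) / real n) \<longlonglongrightarrow> 1 - d"
    using assms unfolding has_density_def by (intro tendsto_intros)
  have "card {k \<in> A. 1 \<le> k \<and> k \<le> n} + card {k \<in> - A. 1 \<le> k \<and> k \<le> n} = n" for n
  proof -
    have "{1..n} = {k \<in> A. 1 \<le> k \<and> k \<le> n} \<union> {k \<in> - A. 1 \<le> k \<and> k \<le> n}"
      by auto
    then have "card {1..n} = card {k \<in> A. 1 \<le> k \<and> k \<le> n} + card {k \<in> - A. 1 \<le> k \<and> k \<le> n}"
      by (simp only:) (rule card_Un_disjoint, auto)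
    then show ?thesis
      by simp
  qed
  then have "real (card {k \<in> - A. 1 \<le> k \<and> k \<le> n}) = real n - real (card {k \<in> A. 1 \<le> k \<and> k \<le> n})" for n
    by (simp add: eq_diff_eq add.commute flip: of_nat_add)
  then have "1 - real (card {k \<in> A. 1 \<le> k \<and> k \<le> n}) / real n
      = real (card {k \<in> - A. 1 \<le> k \<and> k \<le> n}) / real n" if "n > 0" for n
    using that by (simp only: diff_divide_distrib) simp
  then show "\<forall>\<^sub>F n in sequentially. 1 - real (card {k \<in> A. 1 \<le> k \<and> k \<le> n}) / real n
      = real (card {k \<in> - A. 1 \<le> k \<and> k \<le> n}) / real n"
    by (rule eventually_mono[OF eventually_gt_at_top[of 0]])
qed

text \<open>
  The set \<open>Z\<close> takes \<open>B j\<close> only from a threshold \<open>N j\<close> on, where the relative frequency of \<open>B j\<close> has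
  become at most \<open>1 / (j + 1)\<close>. Up to any \<open>n\<close>, only the \<open>B m\<close> whose threshold has been passed
  contribute; they all lie in the last of them, \<open>B j\<close>, so the relative frequency of \<open>Z\<close> is at
  most \<open>1 / (j + 1)\<close>, and \<open>j\<close> grows with \<open>n\<close>.
\<close>

lemma zero_density_absorbs_increasing:
  fixes B :: "nat \<Rightarrow> nat set"
  assumes dens: "\<And>j. has_density (B j) 0" and "mono B"
  obtains Z where "has_density Z 0" "\<And>j. finite (B j - Z)"
proof -
  define f where "f A n = real (card {k \<in> A. 1 \<le> k \<and> k \<le> n}) / real n" for A n
  have "\<exists>M. \<forall>n\<ge>M. f (B j) n \<le> 1 / real (Suc j)" for j
  proof -
    have "\<forall>\<^sub>F n in sequentially. f (B j) n < 1 / real (Suc j)"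
      by (rule order_tendstoD(2)[OF dens[of j, unfolded has_density_def, folded f_def]]) simp
    then show ?thesis
      unfolding eventually_sequentially using less_imp_le by blast
  qed
  then obtain M where M: "\<And>j n. M j \<le> n \<Longrightarrow> f (B j) n \<le> 1 / real (Suc j)"
    by metis
  \<comment> \<open>Adding \<open>j\<close> ensures that only finitely many thresholds lie below any given \<open>n\<close>.\<close>
  define N where "N j = M j + j" for j
  define Z where "Z = {i. \<exists>j. N j \<le> i \<and> i \<in> B j}"
  have bound: "f Z n \<le> 1 / real (Suc p)" if "N p \<le> n" for n p
  proof -
    have ex: "\<exists>j. N j \<le> n \<and> (\<forall>m. N m \<le> n \<longrightarrow> m \<le> j)"
      by (rule Nat.ex_has_greatest_nat[of _ p n]) (use that in \<open>auto simp: N_def\<close>)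
    then obtain j where j: "N j \<le> n" "\<And>m. N m \<le> n \<Longrightarrow> m \<le> j"
      by blast
    have "{k \<in> Z. 1 \<le> k \<and> k \<le> n} \<subseteq> {k \<in> B j. 1 \<le> k \<and> k \<le> n}"
      using j(2) monoD[OF \<open>mono B\<close>] unfolding Z_def by (blast intro: order_trans)
    then have "f Z n \<le> f (B j) n"
      unfolding f_def by (intro divide_right_mono of_nat_mono card_mono) auto
    also have "\<dots> \<le> 1 / real (Suc j)"
      by (rule M) (use j(1) in \<open>simp add: N_def\<close>)
    also have "\<dots> \<le> 1 / real (Suc p)"
      using j(2)[OF that] by (simp add: frac_le)
    finally show ?thesis .
  qed
  have "has_density Z 0"
    unfolding has_density_def f_def[symmetric]
  proof (rule order_tendstoI)
    fix e :: real assume "0 < e"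
    then obtain p where p: "1 / real (Suc p) < e"
      using nat_approx_posE by blast
    have "f Z n < e" if "n \<ge> N p" for n
      using bound[OF that] p by linarith
    then show "\<forall>\<^sub>F n in sequentially. f Z n < e"
      unfolding eventually_sequentially by blast
  next
    fix e :: real assume "e < 0"
    moreover have "0 \<le> f Z n" for n
      unfolding f_def by simp
    ultimately show "\<forall>\<^sub>F n in sequentially. e < f Z n"
      by (intro always_eventually allI) (rule less_le_trans)
  qed
  moreover have "finite (B j - Z)" for j
  proof (rule finite_subset)
    show "B j - Z \<subseteq> {..<N j}"
      unfolding Z_def by (auto simp flip: not_le)
  qed simp
  ultimately show thesis
    by (rule that)
qed

lemma index_sequence_exists:
  assumes "infinite K" "K \<subseteq> {1..}"
  obtains k where "index_sequence k" "k ` {1..} = K"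
proof
  \<comment> \<open>\<open>enumerate\<close> counts from 0, index sequences from 1.\<close>
  let ?k = "\<lambda>n. enumerate K (n - 1)"
  have "?k ` {1..} = enumerate K ` (\<lambda>n. n - 1) ` {1..}"
    by (simp only: image_image)
  also have "(\<lambda>n. n - 1) ` {1::nat..} = UNIV"
  proof -
    have "m \<in> (\<lambda>n. n - 1) ` {1::nat..}" for m
      by (rule image_eqI[of _ _ "Suc m"]) auto
    then show ?thesis
      by blast
  qed
  finally show range: "?k ` {1..} = K"
    by (simp only: range_enumerate[OF assms(1)])
  have "strict_mono_on {1..} ?k"
    by (intro strict_mono_onI enumerate_mono[OF _ assms(1)]) auto
  then show "index_sequence ?k"
    unfolding index_sequence_def range using assms(2) by simp
qed

text \<open>
  An index sequence is injective, so a condition holds for all late members of the subsequence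
  exactly when it fails at only finitely many indices in the range.
\<close>

lemma is_rlim_index_sequence_iff:
  assumes "index_sequence k"
  shows "is_rlim r (\<lambda>n. l (k n)) a \<longleftrightarrow>
    (\<forall>\<epsilon>>0. finite {i \<in> k ` {1..}. \<bar>l i - a\<bar> \<ge> r + \<epsilon>})"
proof -
  have inj: "inj_on k {1..}"
    using assms strict_mono_on_imp_inj_on unfolding index_sequence_def by blast
  have "(\<forall>\<^sub>F n in sequentially. \<bar>l (k n) - a\<bar> < r + \<epsilon>)
      \<longleftrightarrow> finite {i \<in> k ` {1..}. \<bar>l i - a\<bar> \<ge> r + \<epsilon>}" for \<epsilon>
  proof -
    let ?bad = "{n \<in> {1..}. \<bar>l (k n) - a\<bar> \<ge> r + \<epsilon>}"
    have "(\<forall>\<^sub>F n in sequentially. \<bar>l (k n) - a\<bar> < r + \<epsilon>)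
        \<longleftrightarrow> finite {n. \<bar>l (k n) - a\<bar> \<ge> r + \<epsilon>}"
      by (simp add: eventually_cofinite not_less flip: cofinite_eq_sequentially)
    also have "\<dots> \<longleftrightarrow> finite ?bad"
    proof
      assume "finite ?bad"
      moreover have "{n. \<bar>l (k n) - a\<bar> \<ge> r + \<epsilon>} \<subseteq> insert 0 ?bad"
        by auto
      ultimately show "finite {n. \<bar>l (k n) - a\<bar> \<ge> r + \<epsilon>}"
        using finite_subset by blast
    qed (auto elim: rev_finite_subset)
    also have "\<dots> \<longleftrightarrow> finite (k ` ?bad)"
      by (rule finite_image_iff[symmetric]) (rule inj_on_subset[OF inj], auto)
    also have "k ` ?bad = {i \<in> k ` {1..}. \<bar>l i - a\<bar> \<ge> r + \<epsilon>}"
      by auto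
    finally show ?thesis .
  qed
  then show ?thesis
    unfolding is_rlim_def by blast
qed

theorem theorem3p2:
  fixes r :: real and l :: "nat \<Rightarrow> real" and a :: real
  assumes "r \<ge> 0"
  shows "is_stat_rlim r l a \<longleftrightarrow>
    (\<exists>k :: nat \<Rightarrow> nat. index_sequence k \<and> has_density (k ` {1..}) 1 \<and>
       is_rlim r (\<lambda>n. l (k n)) a)"
proof
  assume stat: "is_stat_rlim r l a"
  define B where "B j = {i. 1 \<le> i \<and> \<bar>l i - a\<bar> \<ge> r + 1 / real (Suc j)}" for j
  have "has_density (B j) 0" for j
    using stat unfolding is_stat_rlim_def B_def by simp
  moreover have "mono B"
  proof (rule monoI)
    fix i j :: nat assume "i \<le> j"
    then have "1 / real (Suc j) \<le> 1 / real (Suc i)"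
      by (simp add: frac_le)
    then show "B i \<subseteq> B j"
      unfolding B_def by auto
  qed
  ultimately obtain Z where Z: "has_density Z 0" "\<And>j. finite (B j - Z)"
    using zero_density_absorbs_increasing by blast
  define K where "K = {1..} - Z"
  have "{i \<in> K. 1 \<le> i \<and> i \<le> n} = {i \<in> - Z. 1 \<le> i \<and> i \<le> n}" for n
    unfolding K_def by auto
  then have K1: "has_density K 1"
    using has_density_Compl[OF Z(1)] unfolding has_density_def by simp
  have "infinite K"
  proof
    assume "finite K"
    then have "has_density K 0"
      by (rule has_density_zero_finite)
    then show False
      using K1 LIMSEQ_unique unfolding has_density_def by fastforce
  qed
  then obtain k where k: "index_sequence k" "k ` {1..} = K"
    using index_sequence_exists[of K] unfolding K_def by blast
  have "finite {i \<in> K. \<bar>l i - a\<bar> \<ge> r + \<epsilon>}" if "\<epsilon> > 0" for \<epsilon>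
  proof -
    obtain j where "1 / real (Suc j) < \<epsilon>"
      using \<open>\<epsilon> > 0\<close> nat_approx_posE by blast
    then have "{i \<in> K. \<bar>l i - a\<bar> \<ge> r + \<epsilon>} \<subseteq> B j - Z"
      unfolding K_def B_def by auto
    then show ?thesis
      using Z(2) finite_subset by blast
  qed
  then have "is_rlim r (\<lambda>n. l (k n)) a"
    unfolding is_rlim_index_sequence_iff[OF k(1)] k(2) by blast
  then show "\<exists>k. index_sequence k \<and> has_density (k ` {1..}) 1 \<and> is_rlim r (\<lambda>n. l (k n)) a"
    using k K1 by blast
next
  assume "\<exists>k. index_sequence k \<and> has_density (k ` {1..}) 1 \<and> is_rlim r (\<lambda>n. l (k n)) a"
  then obtain k where k: "index_sequence k" "has_density (k ` {1..}) 1"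
    and lim: "is_rlim r (\<lambda>n. l (k n)) a"
    by blast
  show "is_stat_rlim r l a"
    unfolding is_stat_rlim_def
  proof (intro allI impI)
    fix \<epsilon> :: real assume "\<epsilon> > 0"
    let ?F = "{i \<in> k ` {1..}. \<bar>l i - a\<bar> \<ge> r + \<epsilon>}"
    have "has_density (- k ` {1..}) 0"
      using has_density_Compl[OF k(2)] by simp
    moreover have "has_density ?F 0"
      using lim \<open>\<epsilon> > 0\<close> unfolding is_rlim_index_sequence_iff[OF k(1)]
      by (intro has_density_zero_finite) blast
    ultimately have "has_density (- k ` {1..} \<union> ?F) 0"
      by (rule has_density_zero_Un)
    then show "has_density {i. 1 \<le> i \<and> \<bar>l i - a\<bar> \<ge> r + \<epsilon>} 0"
      by (rule has_density_zero_subset) blast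
  qed
qed

end
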